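(* Let $\mathcal{X}$ be a set of datasets with a distance $d:\mathcal{X}\times\mathcal{X}\to\mathbb{Z}_{\ge0}\cup\{\infty\}$ (symmetric, $d(\mathbf{x},\mathbf{x})=0$, triangle inequality), let $\varepsilon>0$, and let $f:\mathcal{X}\to\mathbb{R}$ be sample-monotone. Fix $\mathbf{x}\in\mathcal{X}$ such that both normalizing integrals $\int_{\mathbb{R}}e^{q_{\texttt{plm}}(y;\mathbf{x})\varepsilon/2}dy$ and $\int_{\mathbb{R}}e^{-\mathrm{len}_f(y;\mathbf{x})\varepsilon/2}dy$ are finite and positive. Let $M_{\texttt{plm}}(\mathbf{x})$ have density proportional to $e^{q_{\texttt{plm}}(y;\mathbf{x})\varepsilon/2}$ and let $M_{\texttt{inv}}(\mathbf{x})$ (the inverse sensitivity mechanism) have density proportional to $e^{-\mathrm{len}_f(y;\mathbf{x})\varepsilon/2}$ on $\mathbb{R}$. Then for all $\alpha\ge0$, $\Pr[|M_{\texttt{plm}}(\mathbf{x})-f(\mathbf{x})|\le\alpha]\ge\Pr[|M_{\texttt{inv}}(\mathbf{x})-f(\mathbf{x})|\le\alpha]$.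
   Context: Inverse sensitivity: $\mathrm{len}_f(y;\mathbf{x})=\inf\{d(\mathbf{x},\mathbf{x}'):f(\mathbf{x}')=y\}$ ($\inf\emptyset=\infty$, $e^{-\infty}=0$). $f$ is sample-monotone if for every $\mathbf{x}$ and all $s,t\in\mathbb{R}$ with $f(\mathbf{x})\le s\le t$ or $t\le s\le f(\mathbf{x})$, $\mathrm{len}_f(s;\mathbf{x})\le\mathrm{len}_f(t;\mathbf{x})$. $\overline{f}(\mathbf{x};\ell)=\sup\{f(\mathbf{x}'):d(\mathbf{x},\mathbf{x}')\le\ell\}$, $\underline{f}(\mathbf{x};\ell)=\inf\{f(\mathbf{x}'):d(\mathbf{x},\mathbf{x}')\le\ell\}$, $\ell(y;\mathbf{x})=\inf\{\ell\in\mathbb{Z}_{\ge0}:\underline{f}(\mathbf{x};\ell)\le y\le\overline{f}(\mathbf{x};\ell)\}$. Quality score: $-q_{\texttt{plm}}(f(\mathbf{x});\mathbf{x})=1$; for $y>f(\mathbf{x})$ with $L=\ell(y;\mathbf{x})<\infty$, $-q_{\texttt{plm}}(y;\mathbf{x})=L+\frac{y-\overline{f}(\mathbf{x};L-1)}{\overline{f}(\mathbf{x};L)-\overline{f}(\mathbf{x};L-1)}$; for $y<f(\mathbf{x})$ with $L<\infty$, $-q_{\texttt{plm}}(y;\mathbf{x})=L+\frac{\underline{f}(\mathbf{x};L-1)-y}{\underline{f}(\mathbf{x};L-1)-\underline{f}(\mathbf{x};L)}$; $q_{\texttt{plm}}=-\infty$ if $\ell(y;\mathbf{x})=\infty$.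
   Formalization: When some dataset at distance 0 from x has a different value of f, the score at level L = 0 refers to the undefined bounds at level -1; these bounds are read as f(x). In all other cases the definition of the score is unchanged. *)

theory Defs
  imports "HOL-Analysis.Analysis"
begin

definition dataset_distance :: "('a \<Rightarrow> 'a \<Rightarrow> enat) \<Rightarrow> bool" where
  "dataset_distance d \<longleftrightarrow>
     (\<forall>x. d x x = 0) \<and> (\<forall>x y. d x y = d y x) \<and> (\<forall>x y z. d x z \<le> d x y + d y z)"

(* In enat the infimum of the empty set is \<infinity>. *)
definition inv_len :: "('a \<Rightarrow> 'a \<Rightarrow> enat) \<Rightarrow> ('a \<Rightarrow> real) \<Rightarrow> real \<Rightarrow> 'a \<Rightarrow> enat" where
  "inv_len d f y x = Inf {d x x' | x'. f x' = y}"

definition sample_monotone :: "('a \<Rightarrow> 'a \<Rightarrow> enat) \<Rightarrow> ('a \<Rightarrow> real) \<Rightarrow> bool" where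
  "sample_monotone d f \<longleftrightarrow>
     (\<forall>x s t. (f x \<le> s \<and> s \<le> t) \<or> (t \<le> s \<and> s \<le> f x)
        \<longrightarrow> inv_len d f s x \<le> inv_len d f t x)"

definition f_upper :: "('a \<Rightarrow> 'a \<Rightarrow> enat) \<Rightarrow> ('a \<Rightarrow> real) \<Rightarrow> 'a \<Rightarrow> nat \<Rightarrow> ereal" where
  "f_upper d f x l = Sup {ereal (f x') | x'. d x x' \<le> enat l}"

definition f_lower :: "('a \<Rightarrow> 'a \<Rightarrow> enat) \<Rightarrow> ('a \<Rightarrow> real) \<Rightarrow> 'a \<Rightarrow> nat \<Rightarrow> ereal" where
  "f_lower d f x l = Inf {ereal (f x') | x'. d x x' \<le> enat l}"

definition level :: "('a \<Rightarrow> 'a \<Rightarrow> enat) \<Rightarrow> ('a \<Rightarrow> real) \<Rightarrow> real \<Rightarrow> 'a \<Rightarrow> enat" where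
  "level d f y x = Inf {enat l | l. f_lower d f x l \<le> ereal y \<and> ereal y \<le> f_upper d f x l}"

(* The bounds at level L - 1. A value y other than f x can have level L = 0 only if some x' with
   d x x' = 0 has f x' different from f x; level -1 is then read as the single value f x. *)
definition f_upper_pred :: "('a \<Rightarrow> 'a \<Rightarrow> enat) \<Rightarrow> ('a \<Rightarrow> real) \<Rightarrow> 'a \<Rightarrow> nat \<Rightarrow> ereal" where
  "f_upper_pred d f x L = (if L = 0 then ereal (f x) else f_upper d f x (L - 1))"

definition f_lower_pred :: "('a \<Rightarrow> 'a \<Rightarrow> enat) \<Rightarrow> ('a \<Rightarrow> real) \<Rightarrow> 'a \<Rightarrow> nat \<Rightarrow> ereal" where
  "f_lower_pred d f x L = (if L = 0 then ereal (f x) else f_lower d f x (L - 1))"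

(* If the outer bound at level L is infinite, the quotient below is finite / \<infinity> = 0 in ereal. *)
definition q_plm :: "('a \<Rightarrow> 'a \<Rightarrow> enat) \<Rightarrow> ('a \<Rightarrow> real) \<Rightarrow> real \<Rightarrow> 'a \<Rightarrow> ereal" where
  "q_plm d f y x =
     (if y = f x then - 1
      else case level d f y x of
             \<infinity> \<Rightarrow> - \<infinity>
           | enat L \<Rightarrow>
               if f x < y
               then - (ereal (real L) + (ereal y - f_upper_pred d f x L) /
                                        (f_upper d f x L - f_upper_pred d f x L))
               else - (ereal (real L) + (f_lower_pred d f x L - ereal y) /
                                        (f_lower_pred d f x L - f_lower d f x L)))"

definition exp_ereal :: "ereal \<Rightarrow> ennreal" where
  "exp_ereal z = (case z of ereal r \<Rightarrow> ennreal (exp r) | PInfty \<Rightarrow> \<infinity> | MInfty \<Rightarrow> 0)"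

definition weight_plm :: "('a \<Rightarrow> 'a \<Rightarrow> enat) \<Rightarrow> ('a \<Rightarrow> real) \<Rightarrow> real \<Rightarrow> 'a \<Rightarrow> real \<Rightarrow> ennreal" where
  "weight_plm d f \<epsilon> x y = exp_ereal (q_plm d f y x * ereal (\<epsilon> / 2))"

definition weight_inv :: "('a \<Rightarrow> 'a \<Rightarrow> enat) \<Rightarrow> ('a \<Rightarrow> real) \<Rightarrow> real \<Rightarrow> 'a \<Rightarrow> real \<Rightarrow> ennreal" where
  "weight_inv d f \<epsilon> x y = exp_ereal (- ereal_of_enat (inv_len d f y x) * ereal (\<epsilon> / 2))"

definition normalized_density :: "(real \<Rightarrow> ennreal) \<Rightarrow> real measure" where
  "normalized_density w = density lborel (\<lambda>y. w y / (\<integral>\<^sup>+ z. w z \<partial>lborel))"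

definition M_plm :: "('a \<Rightarrow> 'a \<Rightarrow> enat) \<Rightarrow> ('a \<Rightarrow> real) \<Rightarrow> real \<Rightarrow> 'a \<Rightarrow> real measure" where
  "M_plm d f \<epsilon> x = normalized_density (weight_plm d f \<epsilon> x)"

definition M_inv :: "('a \<Rightarrow> 'a \<Rightarrow> enat) \<Rightarrow> ('a \<Rightarrow> real) \<Rightarrow> real \<Rightarrow> 'a \<Rightarrow> real measure" where
  "M_inv d f \<epsilon> x = normalized_density (weight_inv d f \<epsilon> x)"

end

theory Submission
  imports Defs
begin

text \<open>
  On each side of \<open>f x\<close> the bounds \<open>f_upper\<close> (resp. \<open>f_lower\<close>) cut the half line into shells. By
  sample monotonicity the inverse sensitivity weight is almost everywhere the constant \<open>e\<^sup>-\<^sup>k\<^sup>n\<close> on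
  the \<open>n\<close>-th shell, where \<open>k = \<epsilon> / 2\<close>, while the piecewise linear weight is \<open>e\<^sup>-\<^sup>k\<^sup>n e\<^sup>-\<^sup>k\<^sup>\<theta>\<close> with
  \<open>\<theta>\<close> running linearly from 0 to 1. Hence the two masses of a full shell have the ratio
  \<open>c = (1 - e\<^sup>-\<^sup>k) / k\<close> whatever the shell, and since \<open>e\<^sup>-\<^sup>k\<^sup>\<theta>\<close> decreases, the ratio for an inner
  part of a shell is at least \<open>c\<close>. So the normalizing integrals have ratio exactly \<open>c\<close>, and the
  masses of a ball around \<open>f x\<close> have ratio at least \<open>c\<close>. An infinitely long shell would make the
  inverse sensitivity integral diverge. The lower side is the upper side of \<open>- f\<close>.
\<close>

section \<open>Weights built from a monotone sequence of shells\<close>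

text \<open>The shells are half-open, so a monotone \<open>a\<close> makes them disjoint and at most
  one term of the series is nonzero at any \<open>y\<close>; the series form lets integrals be taken
  shell by shell.\<close>

definition inv_shells :: "(nat \<Rightarrow> real) \<Rightarrow> real \<Rightarrow> real \<Rightarrow> ennreal" where
  "inv_shells a k y = (\<Sum>n. ennreal (exp (- (k * real n))) * indicator {a n<..a (Suc n)} y)"

text \<open>If \<open>a n = a (Suc n)\<close>, the quotient is a division by zero, but the shell is
  empty and its indicator removes the term.\<close>

definition plm_shells :: "(nat \<Rightarrow> real) \<Rightarrow> real \<Rightarrow> real \<Rightarrow> ennreal" where
  "plm_shells a k y =
     (\<Sum>n. ennreal (exp (- (k * (real n + (y - a n) / (a (Suc n) - a n)))))
            * indicator {a n<..a (Suc n)} y)"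

lemma inv_shells_measurable [measurable]: "inv_shells a k \<in> borel_measurable borel"
  unfolding inv_shells_def by measurable

lemma plm_shells_measurable [measurable]: "plm_shells a k \<in> borel_measurable borel"
  unfolding plm_shells_def by measurable

lemma shell_term_zero:
  fixes a :: "nat \<Rightarrow> real"
  assumes "mono a" "a n < y" "y \<le> a (Suc n)" "m \<noteq> n"
  shows "y \<notin> {a m<..a (Suc m)}"
proof (cases "m < n")
  case True
  then have "a (Suc m) \<le> a n" using assms(1) by (auto intro: monoD)
  then show ?thesis using assms by auto
next
  case False
  then have "a (Suc n) \<le> a m" using assms by (auto intro: monoD)
  then show ?thesis using assms by auto
qed

lemma suminf_single_shell:
  fixes a :: "nat \<Rightarrow> real" and g :: "nat \<Rightarrow> ennreal"
  assumes "mono a" "a n < y" "y \<le> a (Suc n)"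
  shows "(\<Sum>m. g m * indicator {a m<..a (Suc m)} y) = g n"
proof -
  have "(\<Sum>m. g m * indicator {a m<..a (Suc m)} y)
      = (\<Sum>m\<in>{n}. g m * indicator {a m<..a (Suc m)} y)"
    using shell_term_zero[OF assms] by (intro suminf_finite) (auto simp: indicator_def)
  then show ?thesis using assms by simp
qed

lemma inv_shells_eq:
  assumes "mono a" "a n < y" "y \<le> a (Suc n)"
  shows "inv_shells a k y = ennreal (exp (- (k * real n)))"
  unfolding inv_shells_def by (rule suminf_single_shell[OF assms])

lemma plm_shells_eq:
  assumes "mono a" "a n < y" "y \<le> a (Suc n)"
  shows "plm_shells a k y = ennreal (exp (- (k * (real n + (y - a n) / (a (Suc n) - a n)))))"
  unfolding plm_shells_def by (rule suminf_single_shell[OF assms])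

lemma shells_beyond:
  assumes "\<And>n. a n < y"
  shows "inv_shells a k y = 0" "plm_shells a k y = 0"
  using assms unfolding inv_shells_def plm_shells_def by (auto simp: not_le)

section \<open>Mass of one shell, whole or cut, and of all shells\<close>

text \<open>The integrand has the explicit antiderivative \<open>?F\<close>. Keeping the endpoint
  \<open>s\<close> separate from \<open>q\<close> lets the formula serve both whole shells, with
  \<open>s = q\<close>, and cut ones.\<close>

lemma nn_integral_exp_shell:
  fixes p q s k c :: real
  assumes "p < q" "p \<le> s" "k > 0"
  shows "(\<integral>\<^sup>+ y. ennreal (exp (- (k * (c + (y - p) / (q - p))))) * indicator {p<..s} y \<partial>lborel)
     = ennreal (exp (- (k * c)) * ((q - p) / k * (1 - exp (- (k * ((s - p) / (q - p)))))))"
proof -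
  let ?F = "\<lambda>y. - (exp (- (k * (c + (y - p) / (q - p)))) * ((q - p) / k))"
  have "(\<integral>\<^sup>+ y. ennreal (exp (- (k * (c + (y - p) / (q - p))))) * indicator {p<..s} y \<partial>lborel)
      = (\<integral>\<^sup>+ y. ennreal (exp (- (k * (c + (y - p) / (q - p))))) * indicator {p..s} y \<partial>lborel)"
    by (intro nn_integral_cong_AE) (use AE_lborel_singleton[of p] in eventually_elim, auto simp: indicator_def)
  also have "\<dots> = ennreal (?F s - ?F p)"
  proof (intro nn_integral_FTC_Icc)
    fix y
    have "(?F has_real_derivative
        - (exp (- (k * (c + (y - p) / (q - p)))) * (- (k * (1 / (q - p)))) * ((q - p) / k))) (at y)"
      by (auto intro!: derivative_eq_intros)
    moreover have "- (E * (- (k * (1 / (q - p)))) * ((q - p) / k)) = E" for E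
      using assms by simp
    ultimately show "(?F has_real_derivative exp (- (k * (c + (y - p) / (q - p))))) (at y)"
      by simp
  qed (use assms in auto)
  also have "?F s - ?F p
      = exp (- (k * c)) * ((q - p) / k * (1 - exp (- (k * ((s - p) / (q - p))))))"
    by (simp add: exp_add[symmetric] algebra_simps flip: exp_add)
  finally show ?thesis .
qed

text \<open>By convexity, \<open>exp\<close> lies below its chord between \<open>0\<close> and
  \<open>- k\<close>. Here \<theta> will be the fraction of a shell that survives a cut.\<close>

lemma one_minus_exp_chord:
  fixes k \<theta> :: real
  assumes "0 \<le> \<theta>" "\<theta> \<le> 1"
  shows "\<theta> * (1 - exp (- k)) \<le> 1 - exp (- (k * \<theta>))"
proof -
  have "exp ((1 - \<theta>) *\<^sub>R 0 + \<theta> *\<^sub>R (- k)) \<le> (1 - \<theta>) * exp 0 + \<theta> * exp (- k)"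
    using assms by (intro convex_onD[OF exp_convex]) auto
  then show ?thesis by (simp add: algebra_simps)
qed

text \<open>This is the mean of \<open>exp (- (k * \<theta>))\<close> for \<theta> uniform on the
  unit interval.\<close>

definition shell_const :: "real \<Rightarrow> real" where
  "shell_const k = (1 - exp (- k)) / k"

lemma shell_const_pos: "k > 0 \<Longrightarrow> shell_const k > 0"
  by (simp add: shell_const_def)

text \<open>Rescaling the shell to the unit interval turns the linear term into the uniform
  variable, so the factor depends on neither the endpoints nor \<open>c\<close>.\<close>

lemma single_shell_total:
  fixes p q k c :: real
  assumes "p \<le> q" "k > 0"
  shows "(\<integral>\<^sup>+ y. ennreal (exp (- (k * (c + (y - p) / (q - p))))) * indicator {p<..q} y \<partial>lborel)
    = ennreal (shell_const k) * (\<integral>\<^sup>+ y. ennreal (exp (- (k * c))) * indicator {p<..q} y \<partial>lborel)"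
proof (cases "p < q")
  case True
  then show ?thesis
    using nn_integral_exp_shell[OF True _ assms(2), of q c] assms shell_const_pos[OF assms(2)]
    by (simp add: nn_integral_cmult_indicator ennreal_mult'[symmetric])
       (simp add: shell_const_def mult_ac)
next
  case False
  then show ?thesis using assms by simp
qed

text \<open>A cut at \<open>t\<close> keeps the fraction \<theta> of the shell nearest to
  \<open>p\<close>, where the piecewise linear weight is largest; the chord bound makes this
  quantitative.\<close>

lemma single_shell_truncated:
  fixes p q k c t :: real
  assumes "p \<le> q" "k > 0"
  shows "(\<integral>\<^sup>+ y. ennreal (exp (- (k * (c + (y - p) / (q - p))))) * indicator {p<..q} y
                * indicator {..t} y \<partial>lborel)
    \<ge> ennreal (shell_const k)
       * (\<integral>\<^sup>+ y. ennreal (exp (- (k * c))) * indicator {p<..q} y * indicator {..t} y \<partial>lborel)"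
proof -
  have I: "indicator {p<..q} y * indicator {..t} y = (indicator {p<..min q t} y :: ennreal)" for y
    by (auto simp: indicator_def)
  show ?thesis
  proof (cases "p < q \<and> p \<le> t")
    case True
    define s where "s = min q t"
    define \<theta> where "\<theta> = (s - p) / (q - p)"
    have s: "p \<le> s" "s \<le> q" using True by (auto simp: s_def)
    have th: "0 \<le> \<theta>" "\<theta> \<le> 1" "s - p = \<theta> * (q - p)"
      using True s by (auto simp: \<theta>_def)
    have "shell_const k * (exp (- (k * c)) * (s - p))
        = exp (- (k * c)) * ((q - p) / k * (\<theta> * (1 - exp (- k))))"
      by (simp add: th shell_const_def)
    also have "\<dots> \<le> exp (- (k * c)) * ((q - p) / k * (1 - exp (- (k * \<theta>))))"
      using one_minus_exp_chord[OF th(1,2), of k] True assms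
      by (intro mult_left_mono) auto
    finally have "ennreal (shell_const k) * (ennreal (exp (- (k * c))) * ennreal (s - p))
        \<le> ennreal (exp (- (k * c)) * ((q - p) / k * (1 - exp (- (k * \<theta>)))))"
      using s shell_const_pos[OF assms(2)]
      by (simp add: ennreal_mult'[symmetric] ennreal_leI)
    then show ?thesis
      using nn_integral_exp_shell[of p q s k c] True assms(2) s
      unfolding mult.assoc I s_def[symmetric] \<theta>_def
      by (simp add: nn_integral_cmult_indicator)
  next
    case False
    \<comment> \<open>Either the shell is degenerate or the cut lies before it, so both integrals
      vanish.\<close>
    then have empty: "{p<..min q t} = {}" using assms by auto
    show ?thesis unfolding mult.assoc I empty by simp
  qed
qed

lemma shells_total:
  assumes "mono a" "k > 0"
  shows "(\<integral>\<^sup>+ y. plm_shells a k y \<partial>lborel)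
    = ennreal (shell_const k) * (\<integral>\<^sup>+ y. inv_shells a k y \<partial>lborel)"
proof -
  have a: "a n \<le> a (Suc n)" for n using assms(1) by (auto intro: monoD)
  show ?thesis
    unfolding plm_shells_def inv_shells_def
    by (subst (1 2) nn_integral_suminf)
       (simp_all add: single_shell_total[OF a assms(2)] ennreal_suminf_cmult)
qed

lemma shells_truncated:
  assumes "mono a" "k > 0"
  shows "(\<integral>\<^sup>+ y. plm_shells a k y * indicator {..t} y \<partial>lborel)
    \<ge> ennreal (shell_const k) * (\<integral>\<^sup>+ y. inv_shells a k y * indicator {..t} y \<partial>lborel)"
proof -
  have a: "a n \<le> a (Suc n)" for n using assms(1) by (auto intro: monoD)
  show ?thesis
    unfolding plm_shells_def inv_shells_def ennreal_suminf_multc[symmetric]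
    by (subst (1 2) nn_integral_suminf, simp_all, subst ennreal_suminf_cmult[symmetric])
       (intro suminf_le single_shell_truncated[OF a assms(2)], simp_all)
qed

section \<open>Reflection: replacing \<open>f\<close> by its negative\<close>

lemma f_upper_uminus: "f_upper d (\<lambda>z. - f z) x l = - f_lower d f x l"
proof -
  have "{ereal (- f x') |x'. d x x' \<le> enat l} = uminus ` {ereal (f x') |x'. d x x' \<le> enat l}"
    by (auto simp: image_iff) (metis uminus_ereal.simps(1))+
  then show ?thesis
    unfolding f_upper_def f_lower_def by (simp add: ereal_Sup_uminus_image_eq)
qed

lemma f_lower_uminus: "f_lower d (\<lambda>z. - f z) x l = - f_upper d f x l"
  using f_upper_uminus[of d "\<lambda>z. - f z" x l] by simp

lemma level_uminus: "level d (\<lambda>z. - f z) (- y) x = level d f y x"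
proof -
  have "ereal (- y) = - ereal y" by simp
  then show ?thesis
    unfolding level_def f_upper_uminus f_lower_uminus by (simp only: ereal_minus_le_minus conj_commute)
qed

lemma q_plm_uminus: "q_plm d (\<lambda>z. - f z) (- y) x = q_plm d f y x"
proof -
  have 1: "f_upper_pred d (\<lambda>z. - f z) x L = - f_lower_pred d f x L"
       "f_lower_pred d (\<lambda>z. - f z) x L = - f_upper_pred d f x L" for L
    by (simp_all add: f_upper_pred_def f_lower_pred_def f_upper_uminus f_lower_uminus)
  \<comment> \<open>Only commutativity of addition is involved, so this also covers infinite
    bounds.\<close>
  have 2: "- A - - B = B - A" for A B :: ereal
    by (simp add: minus_ereal_def add.commute)
  have 3: "ereal (- y) = - ereal y" by simp
  show ?thesis
    unfolding q_plm_def level_uminus 1 f_upper_uminus f_lower_uminus 3 2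
    by (auto split: enat.split)
qed

lemma weight_plm_uminus: "weight_plm d (\<lambda>z. - f z) \<epsilon> x (- y) = weight_plm d f \<epsilon> x y"
  by (simp add: weight_plm_def q_plm_uminus)

lemma inv_len_uminus: "inv_len d (\<lambda>z. - f z) (- y) x = inv_len d f y x"
  by (simp add: inv_len_def)

lemma weight_inv_uminus: "weight_inv d (\<lambda>z. - f z) \<epsilon> x (- y) = weight_inv d f \<epsilon> x y"
  by (simp add: weight_inv_def inv_len_uminus)

lemma sample_monotone_uminus:
  assumes "sample_monotone d f"
  shows "sample_monotone d (\<lambda>z. - f z)"
  unfolding sample_monotone_def
proof (intro allI impI)
  fix x s t
  assume "- f x \<le> s \<and> s \<le> t \<or> t \<le> s \<and> s \<le> - f x"
  then have "(f x \<le> - s \<and> - s \<le> - t) \<or> (- t \<le> - s \<and> - s \<le> f x)" by auto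
  then have "inv_len d f (- s) x \<le> inv_len d f (- t) x"
    using assms unfolding sample_monotone_def by blast
  then show "inv_len d (\<lambda>z. - f z) s x \<le> inv_len d (\<lambda>z. - f z) t x"
    using inv_len_uminus[of d f "- s" x] inv_len_uminus[of d f "- t" x] by simp
qed

lemma nn_integral_uminus_lborel:
  fixes g :: "real \<Rightarrow> ennreal"
  assumes [measurable]: "g \<in> borel_measurable borel"
  shows "(\<integral>\<^sup>+ y. g (- y) \<partial>lborel) = (\<integral>\<^sup>+ y. g y \<partial>lborel)"
  using nn_integral_real_affine[OF assms, of "-1" 0] by simp

section \<open>Monotonicity and measurability of the inverse sensitivity weight\<close>

lemma exp_ereal_neg: "exp_ereal (- ereal r * ereal k) = ennreal (exp (- (k * r)))"
  by (simp add: exp_ereal_def mult.commute)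

lemma weight_inv_le_len:
  assumes "\<epsilon> > 0" "inv_len d f y x \<le> enat n"
  shows "ennreal (exp (- (\<epsilon> / 2 * real n))) \<le> weight_inv d f \<epsilon> x y"
proof -
  obtain m where m: "inv_len d f y x = enat m" "m \<le> n" using assms(2) by (cases "inv_len d f y x") auto
  have "weight_inv d f \<epsilon> x y = ennreal (exp (- (\<epsilon> / 2 * real m)))"
    unfolding weight_inv_def m(1) ereal_of_enat_simps by (rule exp_ereal_neg)
  then show ?thesis using m(2) assms(1) by (auto intro!: ennreal_leI mult_left_mono)
qed

lemma weight_inv_antimono:
  assumes "\<epsilon> > 0" "inv_len d f s x \<le> inv_len d f t x"
  shows "weight_inv d f \<epsilon> x t \<le> weight_inv d f \<epsilon> x s"
proof (cases "inv_len d f t x")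
  case (enat n)
  have "weight_inv d f \<epsilon> x t = ennreal (exp (- (\<epsilon> / 2 * real n)))"
    unfolding weight_inv_def enat ereal_of_enat_simps by (rule exp_ereal_neg)
  then show ?thesis using weight_inv_le_len[OF assms(1), of d f s x n] assms(2) enat by simp
next
  case infinity
  then show ?thesis using assms(1) by (simp add: weight_inv_def exp_ereal_def)
qed

text \<open>The weight rises up to \<open>f x\<close> and falls afterwards, so its superlevel sets
  are intervals.\<close>

lemma weight_inv_measurable:
  assumes "\<epsilon> > 0" "sample_monotone d f"
  shows "weight_inv d f \<epsilon> x \<in> borel_measurable borel"
proof (rule borel_measurableI_ge)
  fix c
  have "is_interval {y. c \<le> weight_inv d f \<epsilon> x y}"
    unfolding is_interval_1
  proof (clarify)
    fix s t y
    assume h: "c \<le> weight_inv d f \<epsilon> x s" "c \<le> weight_inv d f \<epsilon> x t" "s \<le> y" "y \<le> t"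
    show "c \<le> weight_inv d f \<epsilon> x y"
    \<comment> \<open>The endpoint to compare with is the one on the same side of \<open>f x\<close>
      as \<open>y\<close>, since it is at least as far out.\<close>
    proof (cases "f x \<le> y")
      case True
      then have "inv_len d f y x \<le> inv_len d f t x"
        using assms(2) h(4) unfolding sample_monotone_def by simp
      then show ?thesis using order.trans[OF h(2) weight_inv_antimono[OF assms(1)]] by simp
    next
      case False
      then have "inv_len d f y x \<le> inv_len d f s x"
        using assms(2) h(3) unfolding sample_monotone_def by simp
      then show ?thesis using order.trans[OF h(1) weight_inv_antimono[OF assms(1)]] by simp
    qed
  qed
  then show "{y \<in> space borel. c \<le> weight_inv d f \<epsilon> x y} \<in> sets borel"
    by (simp add: real_interval_borel_measurable)
qed

section \<open>Inverse sensitivity and the upper bounds\<close>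

text \<open>The supremum may fail to be attained, but strictly above \<open>y\<close> some value
  within distance \<open>n\<close> is attained, and sample monotonicity carries its length inwards
  to \<open>y\<close>.\<close>

lemma inv_len_le_of_less_upper:
  assumes "sample_monotone d f" "f x \<le> y" "ereal y < f_upper d f x n"
  shows "inv_len d f y x \<le> enat n"
proof -
  obtain x' where x': "d x x' \<le> enat n" "y < f x'"
    using assms(3) unfolding f_upper_def less_Sup_iff by auto
  have "inv_len d f y x \<le> inv_len d f (f x') x"
    using assms(1,2) x'(2) unfolding sample_monotone_def by (metis less_imp_le)
  also have "\<dots> \<le> d x x'" unfolding inv_len_def by (rule Inf_lower) auto
  finally show ?thesis using x'(1) by simp
qed

lemma le_upper_of_inv_len:
  assumes "inv_len d f y x \<le> enat n"
  shows "ereal y \<le> f_upper d f x n"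
proof -
  \<comment> \<open>The strict bound by the successor yields a dataset realizing the infimum closely
    enough; integrality then returns the bound \<open>n\<close>.\<close>
  have "inv_len d f y x < enat (Suc n)"
    using assms by (rule order.strict_trans1) simp
  then obtain x' where "d x x' < enat (Suc n)" "f x' = y"
    unfolding inv_len_def Inf_less_iff by auto
  then have "d x x' \<le> enat n" by (cases "d x x'") auto
  with \<open>f x' = y\<close> show ?thesis unfolding f_upper_def by (auto intro!: Sup_upper)
qed

lemma f_upper_mono:
  assumes "l \<le> m"
  shows "f_upper d f x l \<le> f_upper d f x m"
proof -
  have "d x x' \<le> enat m" if "d x x' \<le> enat l" for x'
    using that assms by (cases "d x x'") auto
  then show ?thesis unfolding f_upper_def by (intro Sup_subset_mono) blast
qed

lemma f_upper_ge: "dataset_distance d \<Longrightarrow> ereal (f x) \<le> f_upper d f x l"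
  unfolding f_upper_def dataset_distance_def by (rule Sup_upper) (auto intro!: exI[of _ x])

lemma f_lower_le: "dataset_distance d \<Longrightarrow> f_lower d f x l \<le> ereal (f x)"
  unfolding f_lower_def dataset_distance_def by (rule Inf_lower) (auto intro!: exI[of _ x])

text \<open>An infinite bound at level \<open>l\<close> would keep the weight above a positive
  constant on the whole half line from \<open>f x\<close>, contradicting the finite
  integral.\<close>

lemma f_upper_finite:
  assumes "dataset_distance d" "\<epsilon> > 0" "sample_monotone d f"
    and fin: "(\<integral>\<^sup>+ y. weight_inv d f \<epsilon> x y \<partial>lborel) < \<infinity>"
  shows "\<bar>f_upper d f x l\<bar> \<noteq> \<infinity>"
proof -
  have "f_upper d f x l \<noteq> \<infinity>"
  proof
    assume inf: "f_upper d f x l = \<infinity>"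
    have "ennreal (exp (- (\<epsilon> / 2 * real l))) * indicator {f x..} y \<le> weight_inv d f \<epsilon> x y" for y
      using weight_inv_le_len[OF assms(2) inv_len_le_of_less_upper[OF assms(3), of x y l]] inf
      by (auto simp: indicator_def)
    then have "(\<integral>\<^sup>+ y. ennreal (exp (- (\<epsilon> / 2 * real l))) * indicator {f x..} y \<partial>lborel)
        \<le> (\<integral>\<^sup>+ y. weight_inv d f \<epsilon> x y \<partial>lborel)"
      by (intro nn_integral_mono)
    moreover have "emeasure lborel {f x..} = \<infinity>"
    proof (rule ccontr)
      assume "emeasure lborel {f x..} \<noteq> \<infinity>"
      then obtain r where r: "emeasure lborel {f x..} = ennreal r" "0 \<le> r"
        by (cases "emeasure lborel {f x..}") auto
      have "emeasure lborel {f x..f x + (r + 1)} \<le> emeasure lborel {f x..}"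
        by (intro emeasure_mono) auto
      then show False using r by simp
    qed
    ultimately show False using fin by (simp add: nn_integral_cmult_indicator ennreal_mult_top)
  qed
  moreover have "f_upper d f x l \<noteq> - \<infinity>" using f_upper_ge[OF assms(1), of f x l] by auto
  ultimately show ?thesis by auto
qed

section \<open>The shells above \<open>f x\<close>\<close>

text \<open>The index is shifted by one: term 0 is \<open>f x\<close> and term \<open>Suc n\<close>
  is the bound at level \<open>n\<close>, so that shell \<open>n\<close> holds the values of level
  \<open>n\<close>.\<close>

definition upper_seq :: "('a \<Rightarrow> 'a \<Rightarrow> enat) \<Rightarrow> ('a \<Rightarrow> real) \<Rightarrow> 'a \<Rightarrow> nat \<Rightarrow> real" where
  "upper_seq d f x n = real_of_ereal (f_upper_pred d f x n)"

context
  fixes d :: "'a \<Rightarrow> 'a \<Rightarrow> enat" and f :: "'a \<Rightarrow> real" and \<epsilon> :: real and x :: 'a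
  assumes d: "dataset_distance d" and eps: "\<epsilon> > 0" and sm: "sample_monotone d f"
    and fin: "(\<integral>\<^sup>+ y. weight_inv d f \<epsilon> x y \<partial>lborel) < \<infinity>"
begin

lemma ereal_upper_seq: "ereal (upper_seq d f x n) = f_upper_pred d f x n"
  using f_upper_finite[OF d eps sm fin] by (auto simp: upper_seq_def f_upper_pred_def ereal_real')

lemma ereal_upper_seq_Suc: "f_upper d f x n = ereal (upper_seq d f x (Suc n))"
  by (simp add: ereal_upper_seq f_upper_pred_def)

lemma upper_seq_0: "upper_seq d f x 0 = f x"
  by (simp add: upper_seq_def f_upper_pred_def)

lemma mono_upper_seq: "mono (upper_seq d f x)"
proof (rule mono_iff_le_Suc[THEN iffD2], rule allI)
  fix n
  have "ereal (upper_seq d f x n) \<le> ereal (upper_seq d f x (Suc n))"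
    using f_upper_ge[OF d] f_upper_mono[of "n - 1" n] unfolding ereal_upper_seq
    by (auto simp: f_upper_pred_def)
  then show "upper_seq d f x n \<le> upper_seq d f x (Suc n)" by simp
qed

text \<open>The least index whose term reaches \<open>y\<close> is positive because term 0 is
  \<open>f x\<close>; its predecessor numbers the shell.\<close>

lemma above_cases:
  assumes "f x < y"
  obtains (shell) n where "upper_seq d f x n < y" "y \<le> upper_seq d f x (Suc n)"
    | (beyond) "\<And>n. upper_seq d f x n < y"
proof (cases "\<exists>m. y \<le> upper_seq d f x m")
  case True
  define m where "m = (LEAST m. y \<le> upper_seq d f x m)"
  have m: "y \<le> upper_seq d f x m" unfolding m_def using True by (rule LeastI_ex)
  then obtain n where n: "m = Suc n" using assms upper_seq_0 by (cases m) auto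
  have "\<not> y \<le> upper_seq d f x n" using not_less_Least[of n "\<lambda>m. y \<le> upper_seq d f x m"] n m_def by auto
  then show ?thesis using m n shell[of n] by simp
next
  case False
  then show ?thesis using beyond by (auto simp: not_le)
qed

text \<open>Above \<open>f x\<close> the lower bound condition holds at every level, so only the
  upper bounds decide.\<close>

lemma level_above:
  assumes "f x < y"
  shows "level d f y x = Inf {enat l | l. y \<le> upper_seq d f x (Suc l)}"
proof -
  have "f_lower d f x l \<le> ereal y" for l
    using f_lower_le[OF d, of f x l] assms by (meson ereal_less_eq(3) less_imp_le order_trans)
  then show ?thesis by (simp add: level_def ereal_upper_seq_Suc)
qed

lemma level_in_shell:
  assumes "f x < y" "upper_seq d f x n < y" "y \<le> upper_seq d f x (Suc n)"
  shows "level d f y x = enat n"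
  unfolding level_above[OF assms(1)]
proof (rule antisym)
  show "Inf {enat l | l. y \<le> upper_seq d f x (Suc l)} \<le> enat n" using assms by (intro Inf_lower) auto
  show "enat n \<le> Inf {enat l | l. y \<le> upper_seq d f x (Suc l)}"
  proof (rule Inf_greatest, clarsimp)
    fix l assume "y \<le> upper_seq d f x (Suc l)"
    then have "\<not> Suc l \<le> n" using monoD[OF mono_upper_seq, of "Suc l" n] assms by auto
    then show "n \<le> l" by simp
  qed
qed

text \<open>The level is exactly the shell index, also at the right endpoint of a shell, so the
  identity holds at every point above \<open>f x\<close>.\<close>

lemma weight_plm_above:
  assumes y: "f x < y"
  shows "weight_plm d f \<epsilon> x y = plm_shells (upper_seq d f x) (\<epsilon> / 2) y"
  using y
proof (cases rule: above_cases)
  case (shell n)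
  have "q_plm d f y x = - ereal (real n + (y - upper_seq d f x n) /
      (upper_seq d f x (Suc n) - upper_seq d f x n))"
    using y shell unfolding q_plm_def level_in_shell[OF y shell] ereal_upper_seq_Suc
      ereal_upper_seq[symmetric] by simp
  then have "weight_plm d f \<epsilon> x y = ennreal (exp (- (\<epsilon> / 2 * (real n + (y - upper_seq d f x n) /
      (upper_seq d f x (Suc n) - upper_seq d f x n)))))"
    unfolding weight_plm_def by (simp only: exp_ereal_neg)
  then show ?thesis using plm_shells_eq[OF mono_upper_seq shell] by simp
next
  case beyond
  then have "level d f y x = \<infinity>"
    unfolding level_above[OF y] by (simp add: not_le[symmetric] top_enat_def)
  then show ?thesis
    using y eps shells_beyond(2)[OF beyond] by (simp add: weight_plm_def q_plm_def exp_ereal_def)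
qed

text \<open>Within a shell the length is squeezed to the shell index. Endpoints are excluded because
  an unattained supremum gives a larger length there.\<close>

lemma weight_inv_above:
  assumes y: "f x < y" "y \<notin> range (upper_seq d f x)"
  shows "weight_inv d f \<epsilon> x y = inv_shells (upper_seq d f x) (\<epsilon> / 2) y"
  using y(1)
proof (cases rule: above_cases)
  case (shell n)
  have "y \<noteq> upper_seq d f x (Suc n)" using y(2) by auto
  then have "inv_len d f y x \<le> enat n"
    using shell y by (intro inv_len_le_of_less_upper[OF sm]) (auto simp: ereal_upper_seq_Suc)
  then obtain m where m: "inv_len d f y x = enat m" "m \<le> n" by (cases "inv_len d f y x") auto
  have "y \<le> upper_seq d f x (Suc m)"
    using le_upper_of_inv_len[of d f y x m] m by (simp add: ereal_upper_seq_Suc)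
  \<comment> \<open>A length below \<open>n\<close> would place \<open>y\<close> no further out than
    the start of its own shell.\<close>
  then have "\<not> Suc m \<le> n" using monoD[OF mono_upper_seq, of "Suc m" n] shell by auto
  then have "m = n" using m by simp
  then have "weight_inv d f \<epsilon> x y = ennreal (exp (- (\<epsilon> / 2 * real n)))"
    unfolding weight_inv_def m(1) ereal_of_enat_simps by (simp only: exp_ereal_neg)
  then show ?thesis using inv_shells_eq[OF mono_upper_seq shell] by simp
next
  case beyond
  have "inv_len d f y x = \<infinity>"
  proof (cases "inv_len d f y x")
    case (enat m)
    then show ?thesis using le_upper_of_inv_len[of d f y x m] beyond[of "Suc m"]
      by (simp add: ereal_upper_seq_Suc)
  qed auto
  then show ?thesis
    using eps shells_beyond(1)[OF beyond] by (simp add: weight_inv_def exp_ereal_def)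
qed

lemma shells_below:
  assumes "y \<le> f x"
  shows "plm_shells (upper_seq d f x) k y = 0" "inv_shells (upper_seq d f x) k y = 0"
proof -
  have "y \<notin> {upper_seq d f x n<..upper_seq d f x (Suc n)}" for n
    using monoD[OF mono_upper_seq, of 0 n] assms upper_seq_0 by auto
  then show "plm_shells (upper_seq d f x) k y = 0" "inv_shells (upper_seq d f x) k y = 0"
    unfolding plm_shells_def inv_shells_def by simp_all
qed

lemma plm_above_eq_shells:
  "weight_plm d f \<epsilon> x y * indicator {f x<..} y = plm_shells (upper_seq d f x) (\<epsilon> / 2) y"
  using weight_plm_above[of y] shells_below(1)[of y] by (auto simp: indicator_def not_less)

lemma inv_above_eq_shells:
  assumes "y \<notin> range (upper_seq d f x)"
  shows "weight_inv d f \<epsilon> x y * indicator {f x<..} y = inv_shells (upper_seq d f x) (\<epsilon> / 2) y"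
  using weight_inv_above[OF _ assms] shells_below(2)[of y] by (auto simp: indicator_def not_less)

lemma plm_above_measurable:
  "(\<lambda>y. weight_plm d f \<epsilon> x y * indicator {f x<..} y) \<in> borel_measurable borel"
  unfolding plm_above_eq_shells by measurable

text \<open>The exceptional endpoints are countably many, hence a null set.\<close>

lemma AE_inv_above:
  "AE y in lborel. weight_inv d f \<epsilon> x y * indicator {f x<..} y
     = inv_shells (upper_seq d f x) (\<epsilon> / 2) y"
proof -
  have "AE y in lborel. y \<notin> range (upper_seq d f x)"
    by (intro AE_not_in countable_imp_null_set_lborel) simp
  then show ?thesis by eventually_elim (rule inv_above_eq_shells)
qed

lemma above_total:
  "(\<integral>\<^sup>+ y. weight_plm d f \<epsilon> x y * indicator {f x<..} y \<partial>lborel)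
    = ennreal (shell_const (\<epsilon> / 2)) * (\<integral>\<^sup>+ y. weight_inv d f \<epsilon> x y * indicator {f x<..} y \<partial>lborel)"
  unfolding plm_above_eq_shells nn_integral_cong_AE[OF AE_inv_above]
  using eps by (intro shells_total mono_upper_seq) auto

lemma above_truncated:
  "(\<integral>\<^sup>+ y. weight_plm d f \<epsilon> x y * indicator {f x<..} y * indicator {..t} y \<partial>lborel)
    \<ge> ennreal (shell_const (\<epsilon> / 2))
        * (\<integral>\<^sup>+ y. weight_inv d f \<epsilon> x y * indicator {f x<..} y * indicator {..t} y \<partial>lborel)"
proof -
  have "(\<integral>\<^sup>+ y. weight_inv d f \<epsilon> x y * indicator {f x<..} y * indicator {..t} y \<partial>lborel)
      = (\<integral>\<^sup>+ y. inv_shells (upper_seq d f x) (\<epsilon> / 2) y * indicator {..t} y \<partial>lborel)"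
    by (rule nn_integral_cong_AE) (use AE_inv_above in eventually_elim, simp)
  then show ?thesis
    unfolding plm_above_eq_shells using eps shells_truncated[OF mono_upper_seq, of "\<epsilon> / 2"] by simp
qed

end

section \<open>Gluing the two sides and normalizing\<close>

lemma measurable_from_halves:
  fixes w :: "real \<Rightarrow> ennreal"
  assumes 1: "(\<lambda>y. w y * indicator {c<..} y) \<in> borel_measurable borel"
    and 2: "(\<lambda>y. w (- y) * indicator {- c<..} y) \<in> borel_measurable borel"
  shows "w \<in> borel_measurable borel"
proof -
  have "(\<lambda>y. w (- (- y)) * indicator {- c<..} (- y)) \<in> borel_measurable borel"
    using measurable_compose[OF borel_measurable_uminus[OF measurable_ident] 2] by simp
  then have "(\<lambda>y. w y * indicator {c<..} y + w (- (- y)) * indicator {- c<..} (- y))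
      \<in> borel_measurable borel"
    by (intro borel_measurable_add 1)
  then show ?thesis
    \<comment> \<open>The two halves both miss the point \<open>c\<close>, where the sum is 0
      instead of \<open>w c\<close>.\<close>
    by (rule measurable_discrete_difference[where X="{c}"]) (auto simp: indicator_def)
qed

text \<open>The lower half is written in reflected form, so that the results for the upper side
  apply to it with \<open>f\<close> negated.\<close>

lemma nn_integral_halves:
  fixes w :: "real \<Rightarrow> ennreal"
  assumes [measurable]: "w \<in> borel_measurable borel"
  shows "(\<integral>\<^sup>+ y. w y \<partial>lborel) = (\<integral>\<^sup>+ y. w y * indicator {c<..} y \<partial>lborel)
      + (\<integral>\<^sup>+ y. w (- y) * indicator {- c<..} y \<partial>lborel)"
proof -
  have "(\<integral>\<^sup>+ y. w y \<partial>lborel) = (\<integral>\<^sup>+ y. w y * indicator {c<..} y + w y * indicator {..<c} y \<partial>lborel)"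
    by (intro nn_integral_cong_AE)
       (use AE_lborel_singleton[of c] in eventually_elim, auto simp: indicator_def)
  also have "\<dots> = (\<integral>\<^sup>+ y. w y * indicator {c<..} y \<partial>lborel) + (\<integral>\<^sup>+ y. w y * indicator {..<c} y \<partial>lborel)"
    by (rule nn_integral_add) auto
  also have "(\<integral>\<^sup>+ y. w y * indicator {..<c} y \<partial>lborel)
      = (\<integral>\<^sup>+ y. w (- y) * indicator {..<c} (- y) \<partial>lborel)"
    by (rule nn_integral_uminus_lborel[symmetric]) auto
  also have "(\<lambda>y. indicator {..<c} (- y) :: ennreal) = indicator {- c<..}"
    by (auto simp: indicator_def)
  finally show ?thesis by (simp add: fun_eq_iff)
qed

lemma measure_normalized_density:
  assumes [measurable]: "w \<in> borel_measurable borel" "S \<in> sets borel"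
  shows "measure (normalized_density w) S
    = enn2real ((\<integral>\<^sup>+ y. w y * indicator S y \<partial>lborel) / (\<integral>\<^sup>+ y. w y \<partial>lborel))"
proof -
  have "emeasure (normalized_density w) S
      = (\<integral>\<^sup>+ y. (w y * indicator S y) / (\<integral>\<^sup>+ z. w z \<partial>lborel) \<partial>lborel)"
    unfolding normalized_density_def
    by (subst emeasure_density) (auto simp: divide_ennreal_def mult_ac)
  then show ?thesis unfolding measure_def by (simp add: nn_integral_divide)
qed

section \<open>Comparison of the two mechanisms\<close>

theorem theorem2:
  fixes d :: "'a \<Rightarrow> 'a \<Rightarrow> enat" and f :: "'a \<Rightarrow> real" and \<epsilon> :: real and x :: 'a
  assumes "dataset_distance d"
    and "\<epsilon> > 0"
    and "sample_monotone d f"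
    and "0 < (\<integral>\<^sup>+ y. weight_plm d f \<epsilon> x y \<partial>lborel)"
    and "(\<integral>\<^sup>+ y. weight_plm d f \<epsilon> x y \<partial>lborel) < \<infinity>"
    and "0 < (\<integral>\<^sup>+ y. weight_inv d f \<epsilon> x y \<partial>lborel)"
    and "(\<integral>\<^sup>+ y. weight_inv d f \<epsilon> x y \<partial>lborel) < \<infinity>"
  shows "\<forall>\<alpha>\<ge>0. measure (M_plm d f \<epsilon> x) {y. \<bar>y - f x\<bar> \<le> \<alpha>}
                \<ge> measure (M_inv d f \<epsilon> x) {y. \<bar>y - f x\<bar> \<le> \<alpha>}"
proof (intro allI impI)
  fix \<alpha> :: real
  assume "\<alpha> \<ge> 0"
  let ?g = "\<lambda>z. - f z"
  let ?c = "ennreal (shell_const (\<epsilon> / 2))"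
  let ?S = "{y. \<bar>y - f x\<bar> \<le> \<alpha>}"
  let ?P = "weight_plm d f \<epsilon> x" and ?I = "weight_inv d f \<epsilon> x"
  have g_plm: "weight_plm d ?g \<epsilon> x = (\<lambda>y. ?P (- y))" and g_inv: "weight_inv d ?g \<epsilon> x = (\<lambda>y. ?I (- y))"
    using weight_plm_uminus[of d f \<epsilon> x "- _"] weight_inv_uminus[of d f \<epsilon> x "- _"] by auto
  have mI [measurable]: "?I \<in> borel_measurable borel"
    by (rule weight_inv_measurable[OF assms(2,3)])
  have "(\<integral>\<^sup>+ y. weight_inv d ?g \<epsilon> x y \<partial>lborel) < \<infinity>"
    unfolding g_inv nn_integral_uminus_lborel[OF mI] by (rule assms(7))
  \<comment> \<open>These lists supply the hypotheses of the one-sided results for \<open>f\<close>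
    and for its negative.\<close>
  note f_side = assms(1,2,3,7) and g_side = assms(1,2) sample_monotone_uminus[OF assms(3)] this
  have mP [measurable]: "?P \<in> borel_measurable borel"
    using plm_above_measurable[OF f_side] plm_above_measurable[OF g_side]
    unfolding g_plm by (rule measurable_from_halves)
  have S [measurable]: "?S \<in> sets borel" by measurable
  \<comment> \<open>Each half of the ball, the left one after reflection, is an upper half line cut
    at distance \<alpha>, as in \<open>above_truncated\<close>.\<close>
  have halves: "(\<integral>\<^sup>+ y. w y * indicator ?S y \<partial>lborel)
      = (\<integral>\<^sup>+ y. w y * indicator {f x<..} y * indicator {..f x + \<alpha>} y \<partial>lborel)
      + (\<integral>\<^sup>+ y. w (- y) * indicator {- f x<..} y * indicator {..- f x + \<alpha>} y \<partial>lborel)"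
    if [measurable]: "w \<in> borel_measurable borel" for w :: "real \<Rightarrow> ennreal"
  proof -
    have "(\<lambda>y. w y * indicator ?S y * indicator {f x<..} y)
        = (\<lambda>y. w y * indicator {f x<..} y * indicator {..f x + \<alpha>} y)"
      "(\<lambda>y. w (- y) * indicator ?S (- y) * indicator {- f x<..} y)
        = (\<lambda>y. w (- y) * indicator {- f x<..} y * indicator {..- f x + \<alpha>} y)"
      by (auto simp: indicator_def fun_eq_iff)
    then show ?thesis using nn_integral_halves[of "\<lambda>y. w y * indicator ?S y" "f x"] by simp
  qed
  have total: "(\<integral>\<^sup>+ y. ?P y \<partial>lborel) = ?c * (\<integral>\<^sup>+ y. ?I y \<partial>lborel)"
    using above_total[OF f_side] above_total[OF g_side]
    unfolding g_plm g_inv nn_integral_halves[OF mP, of "f x"] nn_integral_halves[OF mI, of "f x"]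
    by (simp add: distrib_left)
  have part: "?c * (\<integral>\<^sup>+ y. ?I y * indicator ?S y \<partial>lborel) \<le> (\<integral>\<^sup>+ y. ?P y * indicator ?S y \<partial>lborel)"
    using above_truncated[OF f_side, of "f x + \<alpha>"] above_truncated[OF g_side, of "- f x + \<alpha>"]
    unfolding g_plm g_inv halves[OF mP] halves[OF mI]
    by (simp add: distrib_left add_mono)
  have c: "?c \<noteq> 0" "?c \<noteq> \<infinity>" using shell_const_pos[of "\<epsilon> / 2"] assms(2) by auto
  \<comment> \<open>Expanding the fraction by \<open>?c\<close> makes its denominator equal to the
    other normalizing integral, by \<open>total\<close>, and its numerator comparable by
    \<open>part\<close>.\<close>
  have "(\<integral>\<^sup>+ y. ?I y * indicator ?S y \<partial>lborel) / (\<integral>\<^sup>+ y. ?I y \<partial>lborel)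
      = (?c * (\<integral>\<^sup>+ y. ?I y * indicator ?S y \<partial>lborel)) / (?c * (\<integral>\<^sup>+ y. ?I y \<partial>lborel))"
    unfolding mult.commute[of ?c] by (rule divide_mult_eq[OF c, symmetric])
  also have "\<dots> \<le> (\<integral>\<^sup>+ y. ?P y * indicator ?S y \<partial>lborel) / (\<integral>\<^sup>+ y. ?P y \<partial>lborel)"
    unfolding total by (rule divide_right_mono_ennreal[OF part])
  finally have le: "(\<integral>\<^sup>+ y. ?I y * indicator ?S y \<partial>lborel) / (\<integral>\<^sup>+ y. ?I y \<partial>lborel)
      \<le> (\<integral>\<^sup>+ y. ?P y * indicator ?S y \<partial>lborel) / (\<integral>\<^sup>+ y. ?P y \<partial>lborel)" .
  \<comment> \<open>Since \<open>enn2real\<close> sends infinity to 0, it preserves the inequality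
    only once the larger quotient is known to be finite.\<close>
  have "(\<integral>\<^sup>+ y. ?P y * indicator ?S y \<partial>lborel) \<le> (\<integral>\<^sup>+ y. ?P y \<partial>lborel)"
    by (intro nn_integral_mono) (auto simp: indicator_def)
  then have "(\<integral>\<^sup>+ y. ?P y * indicator ?S y \<partial>lborel) / (\<integral>\<^sup>+ y. ?P y \<partial>lborel) < top"
    using assms(4,5) by (auto simp: ennreal_divide_eq_top_iff less_top[symmetric] top_unique)
  then show "measure (M_inv d f \<epsilon> x) ?S \<le> measure (M_plm d f \<epsilon> x) ?S"
    unfolding M_inv_def M_plm_def measure_normalized_density[OF mI S]
      measure_normalized_density[OF mP S]
    using le by (intro enn2real_mono)
qed

end
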